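(* Let $N\ge2$, let $\gamma_1,\gamma_2,V_1,V_2>0$, and let $a_{i,j}=a_{j,i}\ge0$ for $i,j=1,\dots,N$ with associated Laplacian matrix $L$. Assume that $g_1,g_2:\mathbb R_{\ge0}\to\mathbb R_{\ge0}$ are Lipschitz continuous, with Lipschitz constants $\ell_1$ and $\ell_2$ respectively, are either both monotonically increasing or both monotonically decreasing, and that at least one of them is bounded. Consider the networked system on the state space $\mathcal B^N$, $$\dot X_1=-(\gamma_1I_N+L)X_1+V_1G_2(X_2),\qquad \dot X_2=-\gamma_2X_2+V_2G_1(X_1),$$ where $X_\ell=[x_{\ell,1},\dots,x_{\ell,N}]^T$ and $G_\ell(X_\ell)=[g_\ell(x_{\ell,1}),\dots,g_\ell(x_{\ell,N})]^T$ for $\ell=1,2$. Let $\lambda_2$ be the algebraic connectivity of $L$. If $$\frac{V_1\ell_1V_2\ell_2}{(\gamma_1+\lambda_2)\gamma_2}<1,$$ then every equilibrium $\overline X=[\overline X_1,\overline X_2]$ of the system satisfies $\overline X_1\in\operatorname{span}\{\mathbb 1_N\}$ and $\overline X_2\in\operatorname{span}\{\mathbb 1_N\}$, where $\mathbb 1_N\in\mathbb R^N$ is the vector with all entries equal to one.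
   Context: "Monotonically increasing (decreasing)" means non-decreasing (non-increasing). The Laplacian $L=[l_{ij}]$ has entries $l_{ij}=-a_{i,j}$ for $i\ne j$ and $l_{ii}=\sum_{j\ne i}a_{i,j}$. The algebraic connectivity of $L$ is $\lambda_2=\min_{z\in\mathcal P}z^TLz$ with $\mathcal P=\{z\in\mathbb R^N: z\perp\mathbb 1_N,\ \|z\|=1\}$. The state space is $\mathcal B^N=\prod_{i=1}^N\mathcal B$, where $\mathcal B=[0,\bar x_1]\times[0,\bar x_2]$ with $\bar x_1,\bar x_2>0$ is a box that is forward invariant for the single-compartment dynamics $\dot x_1=-\gamma_1x_1+V_1g_2(x_2)$, $\dot x_2=-\gamma_2x_2+V_2g_1(x_1)$; the $i$-th factor contains $(x_{1,i},x_{2,i})$. *)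

theory Defs
  imports "HOL-Analysis.Analysis"
begin

(* The diagonal weights a $ i $ i do not enter. *)
definition laplacian :: "real ^ 'n ^ 'n \<Rightarrow> real ^ 'n ^ 'n" where
  "laplacian a = (\<chi> i j. if i = j then (\<Sum>k \<in> UNIV - {i}. a $ i $ k) else - (a $ i $ j))"

definition unit_sphere_perp_one :: "(real ^ 'n) set" where
  "unit_sphere_perp_one = {z. orthogonal z 1 \<and> norm z = 1}"

(* The infimum is a minimum as soon as there are at least two nodes, see
   algebraic_connectivity_attained below; for a single node the set is empty. *)
definition algebraic_connectivity :: "real ^ 'n ^ 'n \<Rightarrow> real" where
  "algebraic_connectivity L = (INF z \<in> unit_sphere_perp_one. z \<bullet> (L *v z))"

lemma unit_sphere_perp_one_nonempty:
  assumes "CARD('n::finite) \<ge> 2"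
  shows "(unit_sphere_perp_one :: (real ^ 'n) set) \<noteq> {}"
proof -
  obtain i j :: 'n where ij: "i \<noteq> j"
    using assms by (metis (full_types) One_nat_def UNIV_I card_2_iff' card_le_Suc0_iff_eq
        finite not_less_eq_eq numeral_2_eq_2)
  define w :: "real ^ 'n" where "w = axis i 1 - axis j 1"
  have "w $ i = 1" using ij by (simp add: w_def axis_def)
  then have w0: "w \<noteq> 0" by (metis zero_index zero_neq_one)
  have "w \<bullet> 1 = 0" by (simp add: w_def inner_diff_left inner_axis' )
  then have "(1 / norm w) *\<^sub>R w \<in> unit_sphere_perp_one"
    using w0 by (simp add: unit_sphere_perp_one_def orthogonal_def)
  then show ?thesis by blast
qed

lemma algebraic_connectivity_attained:
  fixes L :: "real ^ 'n ^ 'n"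
  assumes "CARD('n) \<ge> 2"
  shows "\<exists>z \<in> unit_sphere_perp_one. algebraic_connectivity L = z \<bullet> (L *v z) \<and>
           (\<forall>y \<in> unit_sphere_perp_one. z \<bullet> (L *v z) \<le> y \<bullet> (L *v y))"
proof -
  have eq: "(unit_sphere_perp_one :: (real ^ 'n) set) = {z. z \<bullet> 1 = 0} \<inter> sphere 0 1"
    by (auto simp: unit_sphere_perp_one_def orthogonal_def)
  have "closed {z :: real ^ 'n. z \<bullet> 1 = 0}"
    by (intro closed_Collect_eq continuous_intros)
  then have "compact (unit_sphere_perp_one :: (real ^ 'n) set)"
    unfolding eq by (intro closed_Int_compact compact_sphere)
  moreover have "continuous_on unit_sphere_perp_one (\<lambda>z. z \<bullet> (L *v z))"
    by (intro continuous_intros matrix_vector_mult_linear_continuous_on)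
  ultimately obtain z where z: "z \<in> unit_sphere_perp_one"
      "\<forall>y \<in> unit_sphere_perp_one. z \<bullet> (L *v z) \<le> y \<bullet> (L *v y)"
    using continuous_attains_inf[OF _ unit_sphere_perp_one_nonempty[OF assms]] by blast
  then have "algebraic_connectivity L = z \<bullet> (L *v z)"
    unfolding algebraic_connectivity_def by (intro cInf_eq_minimum) auto
  with z show ?thesis by blast
qed

definition is_solution_on :: "('a::real_normed_vector \<Rightarrow> 'a) \<Rightarrow> 'a set \<Rightarrow> real \<Rightarrow> (real \<Rightarrow> 'a) \<Rightarrow> bool" where
  "is_solution_on f D T x \<longleftrightarrow>
     (\<forall>t \<in> {0..T}. x t \<in> D \<and> (x has_vector_derivative f (x t)) (at t within {0..T}))"

(* D is the domain of the vector field f. *)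
definition forward_invariant :: "('a::real_normed_vector \<Rightarrow> 'a) \<Rightarrow> 'a set \<Rightarrow> 'a set \<Rightarrow> bool" where
  "forward_invariant f D S \<longleftrightarrow> S \<subseteq> D \<and>
     (\<forall>T \<ge> 0. \<forall>x. is_solution_on f D T x \<longrightarrow> x 0 \<in> S \<longrightarrow> (\<forall>t \<in> {0..T}. x t \<in> S))"

definition is_equilibrium :: "('a::real_normed_vector \<Rightarrow> 'a) \<Rightarrow> 'a set \<Rightarrow> 'a \<Rightarrow> bool" where
  "is_equilibrium f S x \<longleftrightarrow> x \<in> S \<and> f x = 0"

definition compartment_field ::
  "real \<Rightarrow> real \<Rightarrow> real \<Rightarrow> real \<Rightarrow> (real \<Rightarrow> real) \<Rightarrow> (real \<Rightarrow> real) \<Rightarrow> real \<times> real \<Rightarrow> real \<times> real" where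
  "compartment_field \<gamma>1 \<gamma>2 V1 V2 g1 g2 =
     (\<lambda>(x1, x2). (- \<gamma>1 * x1 + V1 * g2 x2, - \<gamma>2 * x2 + V2 * g1 x1))"

definition state_box :: "real \<Rightarrow> real \<Rightarrow> (real \<times> real) set" where
  "state_box xbar1 xbar2 = {0..xbar1} \<times> {0..xbar2}"

definition componentwise :: "(real \<Rightarrow> real) \<Rightarrow> real ^ 'n \<Rightarrow> real ^ 'n" where
  "componentwise g X = (\<chi> i. g (X $ i))"

definition network_field ::
  "real ^ 'n ^ 'n \<Rightarrow> real \<Rightarrow> real \<Rightarrow> real \<Rightarrow> real \<Rightarrow> (real \<Rightarrow> real) \<Rightarrow> (real \<Rightarrow> real)
     \<Rightarrow> (real ^ 'n) \<times> (real ^ 'n) \<Rightarrow> (real ^ 'n) \<times> (real ^ 'n)" where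
  "network_field L \<gamma>1 \<gamma>2 V1 V2 g1 g2 =
     (\<lambda>(X1, X2). (- (\<gamma>1 *\<^sub>R mat 1 + L) *v X1 + V1 *\<^sub>R componentwise g2 X2,
                  - \<gamma>2 *\<^sub>R X2 + V2 *\<^sub>R componentwise g1 X1))"

definition network_states :: "(real \<times> real) set \<Rightarrow> ((real ^ 'n) \<times> (real ^ 'n)) set" where
  "network_states B = {(X1, X2). \<forall>i. (X1 $ i, X2 $ i) \<in> B}"

end

theory Submission
  imports Defs
begin

text \<open>
  An equilibrium of the network is determined by its first component: the second equation gives
  \<open>X2 = (V2 / \<gamma>2) G1(X1)\<close>, and substituting it in the first leaves the single equation
  \<open>\<gamma>1 X1 + L X1 = V1 H(X1)\<close>, in which \<open>H\<close> applies the scalar function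
  \<open>h x = g2 ((V2 / \<gamma>2) g1 x)\<close> at each node. This \<open>h\<close> is Lipschitz with constant
  \<open>l2 (V2 / \<gamma>2) l1\<close>.

  Such an equation is a contest between diffusion and reaction. Let \<open>z\<close> be the deviation of
  \<open>X1\<close> from its mean \<open>m\<close>, and take the inner product of the equation with \<open>z\<close>. Since \<open>z\<close> is
  orthogonal to constant vectors and \<open>L\<close> annihilates them, the left-hand side is
  \<open>\<gamma>1 |z|\<^sup>2 + z \<bullet> L z\<close>, at least \<open>(\<gamma>1 + \<lambda>2) |z|\<^sup>2\<close> by the variational characterisation of the
  algebraic connectivity \<open>\<lambda>2\<close> (\<open>algebraic_connectivity_le_quadratic_form\<close>). On the
  right-hand side \<open>H(X1)\<close> may be replaced by \<open>H(X1) - h(m) 1\<close>, whose entries are bounded by a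
  multiple of those of \<open>z\<close>; hence it is at most \<open>V1 l2 (V2 / \<gamma>2) l1 |z|\<^sup>2\<close>. The
  small-gain hypothesis says \<open>V1 l2 (V2 / \<gamma>2) l1 < \<gamma>1 + \<lambda>2\<close>, so \<open>z = 0\<close>; this is
  \<open>diffusive_balance_imp_constant\<close>. The nonnegativity of \<open>\<lambda>2\<close>, from the weights being
  symmetric and nonnegative, is what allows the hypothesis on the quotient to be multiplied out.
\<close>

lemma laplacian_mult_component:
  "(laplacian a *v x) $ i = (\<Sum>j\<in>UNIV. a $ i $ j * (x $ i - x $ j))"
proof -
  have "(laplacian a *v x) $ i = (\<Sum>j\<in>UNIV. laplacian a $ i $ j * x $ j)"
    by (simp add: matrix_vector_mult_def)
  also have "\<dots> = laplacian a $ i $ i * x $ i + (\<Sum>j\<in>UNIV - {i}. laplacian a $ i $ j * x $ j)"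
    by (simp add: sum.remove)
  also have "(\<Sum>j\<in>UNIV - {i}. laplacian a $ i $ j * x $ j) = (\<Sum>j\<in>UNIV - {i}. - (a $ i $ j * x $ j))"
    by (rule sum.cong) (auto simp: laplacian_def)
  also have "laplacian a $ i $ i * x $ i = (\<Sum>j\<in>UNIV - {i}. a $ i $ j * x $ i)"
    by (simp add: laplacian_def sum_distrib_right)
  also have "(\<Sum>j\<in>UNIV - {i}. a $ i $ j * x $ i) + (\<Sum>j\<in>UNIV - {i}. - (a $ i $ j * x $ j))
      = (\<Sum>j\<in>UNIV - {i}. a $ i $ j * (x $ i - x $ j))"
    by (simp add: sum.distrib[symmetric] right_diff_distrib)
  also have "\<dots> = (\<Sum>j\<in>UNIV. a $ i $ j * (x $ i - x $ j))"
    by (simp add: sum.remove[of UNIV i])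
  finally show ?thesis .
qed

lemma laplacian_mult_one: "laplacian a *v 1 = 0"
  by (simp add: vec_eq_iff laplacian_mult_component)

text \<open>Exchanging the roles of the two ends of each edge and averaging turns the form into a
  weighted sum of squares.\<close>

lemma laplacian_quadratic_form_nonneg:
  fixes a :: "real ^ 'n ^ 'n"
  assumes sym: "\<And>i j. a $ i $ j = a $ j $ i" and nonneg: "\<And>i j. a $ i $ j \<ge> 0"
  shows "0 \<le> z \<bullet> (laplacian a *v z)"
proof -
  let ?S = "\<Sum>i\<in>UNIV. \<Sum>j\<in>UNIV. a $ i $ j * (z $ i * (z $ i - z $ j))"
  have form: "z \<bullet> (laplacian a *v z) = ?S"
    by (simp add: inner_vec_def laplacian_mult_component sum_distrib_left mult.left_commute)
  have "?S = (\<Sum>i\<in>UNIV. \<Sum>j\<in>UNIV. a $ j $ i * (z $ j * (z $ j - z $ i)))"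
    by (rule sum.swap)
  also have "\<dots> = (\<Sum>i\<in>UNIV. \<Sum>j\<in>UNIV. a $ i $ j * (z $ j * (z $ j - z $ i)))"
    by (subst sym) (rule refl)
  finally have "2 * ?S = ?S + (\<Sum>i\<in>UNIV. \<Sum>j\<in>UNIV. a $ i $ j * (z $ j * (z $ j - z $ i)))"
    by simp
  also have "\<dots> = (\<Sum>i\<in>UNIV. \<Sum>j\<in>UNIV. a $ i $ j * (z $ i - z $ j)\<^sup>2)"
    by (simp add: sum.distrib[symmetric] power2_eq_square algebra_simps)
  also have "\<dots> \<ge> 0"
    by (intro sum_nonneg mult_nonneg_nonneg nonneg zero_le_power2)
  finally show ?thesis
    using form by simp
qed

lemma algebraic_connectivity_laplacian_nonneg:
  fixes a :: "real ^ 'n ^ 'n"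
  assumes "CARD('n) \<ge> 2" "\<And>i j. a $ i $ j = a $ j $ i" "\<And>i j. a $ i $ j \<ge> 0"
  shows "0 \<le> algebraic_connectivity (laplacian a)"
  using algebraic_connectivity_attained[OF assms(1), of "laplacian a"]
    laplacian_quadratic_form_nonneg[OF assms(2,3)]
  by auto

text \<open>The quadratic form is homogeneous of degree two, so its minimum over unit vectors controls
  it on the whole hyperplane.\<close>

lemma algebraic_connectivity_le_quadratic_form:
  fixes L :: "real ^ 'n ^ 'n"
  assumes card: "CARD('n) \<ge> 2" and orth: "orthogonal z 1"
  shows "algebraic_connectivity L * (norm z)\<^sup>2 \<le> z \<bullet> (L *v z)"
proof (cases "z = 0")
  case False
  define u where "u = (1 / norm z) *\<^sub>R z"
  have z: "z = norm z *\<^sub>R u"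
    using False by (simp add: u_def)
  have "u \<in> unit_sphere_perp_one"
    using False orth by (simp add: u_def unit_sphere_perp_one_def orthogonal_def)
  then have "algebraic_connectivity L \<le> u \<bullet> (L *v u)"
    using algebraic_connectivity_attained[OF card, of L] by auto
  then have "algebraic_connectivity L * (norm z)\<^sup>2 \<le> (u \<bullet> (L *v u)) * (norm z)\<^sup>2"
    by (rule mult_right_mono) simp
  also have "\<dots> = (norm z *\<^sub>R u) \<bullet> (L *v (norm z *\<^sub>R u))"
    by (simp add: power2_eq_square matrix_vector_mult_scaleR mult_ac)
  finally show ?thesis
    using z by simp
qed simp

text \<open>Orthogonality to the constants lets \<open>h m\<close> be subtracted at every node for free, after which
  the Lipschitz bound applies entry by entry.\<close>

lemma inner_componentwise_deviation_le:
  fixes X :: "real ^ 'n"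
  assumes lip: "C-lipschitz_on S h" and X: "\<And>i. X $ i \<in> S" and m: "m \<in> S"
    and orth: "orthogonal (X - m *\<^sub>R 1) 1"
  shows "(X - m *\<^sub>R 1) \<bullet> componentwise h X \<le> C * (norm (X - m *\<^sub>R 1))\<^sup>2"
proof -
  let ?z = "X - m *\<^sub>R 1"
  have "?z \<bullet> componentwise h X = ?z \<bullet> (componentwise h X - h m *\<^sub>R 1)"
    using orth by (simp add: orthogonal_def inner_diff_right)
  also have "\<dots> = (\<Sum>i\<in>UNIV. (X $ i - m) * (h (X $ i) - h m))"
    by (simp add: inner_vec_def componentwise_def)
  also have "\<dots> \<le> (\<Sum>i\<in>UNIV. C * (X $ i - m)\<^sup>2)"
  proof (rule sum_mono)
    fix i
    have "\<bar>h (X $ i) - h m\<bar> \<le> C * \<bar>X $ i - m\<bar>"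
      using lipschitz_onD[OF lip X[of i] m] by (simp add: dist_real_def)
    then have "\<bar>X $ i - m\<bar> * \<bar>h (X $ i) - h m\<bar> \<le> \<bar>X $ i - m\<bar> * (C * \<bar>X $ i - m\<bar>)"
      by (rule mult_left_mono) simp
    also have "\<dots> = C * (X $ i - m)\<^sup>2"
      by (simp add: power2_eq_square mult.left_commute)
    finally show "(X $ i - m) * (h (X $ i) - h m) \<le> C * (X $ i - m)\<^sup>2"
      using abs_ge_self[of "(X $ i - m) * (h (X $ i) - h m)"] by (simp add: abs_mult)
  qed
  also have "\<dots> = C * (norm ?z)\<^sup>2"
    unfolding power2_norm_eq_inner
    by (simp add: inner_vec_def sum_distrib_left power2_eq_square)
  finally show ?thesis .
qed

text \<open>The domain is taken convex so that it contains the mean of the entries, at which \<open>h\<close> is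
  compared with its values at the nodes.\<close>

lemma diffusive_balance_imp_constant:
  fixes a :: "real ^ 'n ^ 'n" and X :: "real ^ 'n"
  assumes card: "CARD('n) \<ge> 2"
    and lip: "C-lipschitz_on S h" and conv: "convex S" and X: "\<And>i. X $ i \<in> S"
    and balance: "\<gamma> *\<^sub>R X + laplacian a *v X = V *\<^sub>R componentwise h X"
    and "V \<ge> 0" and gain: "V * C < \<gamma> + algebraic_connectivity (laplacian a)"
  shows "X \<in> span {1}"
proof -
  let ?L = "laplacian a"
  define m where "m = (\<Sum>i\<in>UNIV. (1 / CARD('n)) *\<^sub>R (X $ i))"
  define z where "z = X - m *\<^sub>R 1"
  have m: "m \<in> S"
    unfolding m_def by (rule convex_sum[OF _ conv]) (use X in auto)
  have "(\<Sum>i\<in>UNIV. X $ i) = CARD('n) * m"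
    by (simp add: m_def sum_divide_distrib[symmetric])
  then have orth: "orthogonal z 1"
    by (simp add: orthogonal_def z_def inner_vec_def sum_subtractf)
  have Xz: "X = z + m *\<^sub>R 1"
    by (simp add: z_def)
  have "z \<bullet> X = (norm z)\<^sup>2"
    using orth by (subst Xz) (simp add: inner_add_right orthogonal_def power2_norm_eq_inner)
  moreover have "?L *v X = ?L *v z"
    by (subst Xz) (simp add: matrix_vector_right_distrib matrix_vector_mult_scaleR laplacian_mult_one)
  ultimately have "\<gamma> * (norm z)\<^sup>2 + z \<bullet> (?L *v z) = z \<bullet> (\<gamma> *\<^sub>R X + ?L *v X)"
    by (simp add: inner_add_right)
  also have "\<dots> = V * (z \<bullet> componentwise h X)"
    unfolding balance by simp
  also have "\<dots> \<le> V * (C * (norm z)\<^sup>2)"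
    using inner_componentwise_deviation_le[OF lip X m] orth \<open>V \<ge> 0\<close>
    unfolding z_def by (intro mult_left_mono) auto
  finally have "(\<gamma> + algebraic_connectivity ?L) * (norm z)\<^sup>2 \<le> (V * C) * (norm z)\<^sup>2"
    using algebraic_connectivity_le_quadratic_form[OF card orth, of ?L]
    by (simp add: distrib_right mult.assoc)
  then have "(norm z)\<^sup>2 \<le> 0"
    using gain by (simp add: mult_le_cancel_right not_less)
  then have "X = m *\<^sub>R 1"
    by (simp add: z_def)
  then show ?thesis
    by (auto simp: span_singleton)
qed

lemma componentwise_in_span_one:
  assumes "X \<in> span {1}"
  shows "componentwise g X \<in> span {1}"
proof -
  obtain k where "X = k *\<^sub>R 1"
    using assms by (auto simp: span_singleton)
  then have "componentwise g X = g k *\<^sub>R 1"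
    by (simp add: componentwise_def vec_eq_iff)
  then show ?thesis
    by (auto simp: span_singleton)
qed

theorem mainTheorem2:
  fixes a :: "real ^ 'n ^ 'n"
    and \<gamma>1 \<gamma>2 V1 V2 xbar1 xbar2 l1 l2 :: real
    and g1 g2 :: "real \<Rightarrow> real"
  assumes "CARD('n) \<ge> 2"
    and "\<gamma>1 > 0" and "\<gamma>2 > 0" and "V1 > 0" and "V2 > 0"
    and "\<And>i j. a $ i $ j = a $ j $ i" and "\<And>i j. a $ i $ j \<ge> 0"
    and "g1 ` {0..} \<subseteq> {0..}" and "g2 ` {0..} \<subseteq> {0..}"
    and "l1-lipschitz_on {0..} g1" and "l2-lipschitz_on {0..} g2"
    and "(mono_on {0..} g1 \<and> mono_on {0..} g2) \<or> (antimono_on {0..} g1 \<and> antimono_on {0..} g2)"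
    and "bounded (g1 ` {0..}) \<or> bounded (g2 ` {0..})"
    and "xbar1 > 0" and "xbar2 > 0"
    and "forward_invariant (compartment_field \<gamma>1 \<gamma>2 V1 V2 g1 g2) ({0..} \<times> {0..}) (state_box xbar1 xbar2)"
    and "V1 * l1 * V2 * l2 / ((\<gamma>1 + algebraic_connectivity (laplacian a)) * \<gamma>2) < 1"
  shows "\<forall>X1 X2. is_equilibrium (network_field (laplacian a) \<gamma>1 \<gamma>2 V1 V2 g1 g2)
             (network_states (state_box xbar1 xbar2)) (X1, X2) \<longrightarrow>
           X1 \<in> span {1} \<and> X2 \<in> span {1}"
proof (intro allI impI)
  fix X1 X2 :: "real ^ 'n"
  assume eq: "is_equilibrium (network_field (laplacian a) \<gamma>1 \<gamma>2 V1 V2 g1 g2)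
    (network_states (state_box xbar1 xbar2)) (X1, X2)"
  let ?r = "V2 / \<gamma>2" and ?conn = "algebraic_connectivity (laplacian a)"
  define h where "h = (\<lambda>x. g2 (?r * g1 x))"
  have X1: "X1 $ i \<in> {0..}" for i
    using eq by (auto simp: is_equilibrium_def network_states_def state_box_def)
  have "- laplacian a *v X1 = - (laplacian a *v X1)"
    by (simp add: vec_eq_iff matrix_vector_mult_def sum_negf)
  then have eq1: "\<gamma>1 *\<^sub>R X1 + laplacian a *v X1 = V1 *\<^sub>R componentwise g2 X2"
    and "\<gamma>2 *\<^sub>R X2 = V2 *\<^sub>R componentwise g1 X1"
    using eq
    by (auto simp: is_equilibrium_def network_field_def zero_prod_def algebra_simps
        matrix_vector_mult_diff_rdistrib matrix_vector_mult_add_rdistrib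
        scaleR_matrix_vector_assoc[symmetric])
  then have X2: "X2 = ?r *\<^sub>R componentwise g1 X1"
    using \<open>\<gamma>2 > 0\<close> by (metis (no_types) divide_inverse_commute less_irrefl scaleR_scaleR
        left_inverse scaleR_one)
  have "componentwise g2 X2 = componentwise h X1"
    by (simp add: X2 h_def componentwise_def)
  with eq1 have balance: "\<gamma>1 *\<^sub>R X1 + laplacian a *v X1 = V1 *\<^sub>R componentwise h X1"
    by simp
  have lip: "(l2 * (?r * l1))-lipschitz_on {0..} h"
  proof -
    have "(?r * l1)-lipschitz_on {0..} (\<lambda>x. ?r * g1 x)"
      using lipschitz_on_cmult_real[OF \<open>l1-lipschitz_on {0..} g1\<close>, of ?r] \<open>V2 > 0\<close> \<open>\<gamma>2 > 0\<close>
      by simp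
    moreover have "l2-lipschitz_on ((\<lambda>x. ?r * g1 x) ` {0..}) g2"
      using \<open>V2 > 0\<close> \<open>\<gamma>2 > 0\<close> \<open>g1 ` {0..} \<subseteq> {0..}\<close>
      by (intro lipschitz_on_subset[OF \<open>l2-lipschitz_on {0..} g2\<close>]) auto
    ultimately show ?thesis
      unfolding h_def by (rule lipschitz_on_compose2)
  qed
  have "?conn \<ge> 0"
    using assms by (intro algebraic_connectivity_laplacian_nonneg) auto
  then have denom: "(\<gamma>1 + ?conn) * \<gamma>2 > 0"
    using \<open>\<gamma>1 > 0\<close> \<open>\<gamma>2 > 0\<close> by simp
  have "V1 * (l2 * (?r * l1)) < \<gamma>1 + ?conn"
    using assms(17) denom \<open>\<gamma>2 > 0\<close> by (simp add: pos_divide_less_eq) (simp add: field_simps)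
  then have "X1 \<in> span {1}"
    using diffusive_balance_imp_constant[OF \<open>CARD('n) \<ge> 2\<close> lip convex_real_interval(1) X1 balance]
      \<open>V1 > 0\<close> by simp
  moreover from this have "X2 \<in> span {1}"
    unfolding X2 by (intro span_mul componentwise_in_span_one)
  ultimately show "X1 \<in> span {1} \<and> X2 \<in> span {1}"
    by simp
qed

end
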